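(* Let $X$ be a right quaternionic Banach space and $T:D(T)\subseteq X\to X$ a closed right linear operator. Assume that there exists $\omega\in[0,\pi]$ such that $S_\omega:=\{te^{i\omega}\mid t>0,\ i\in\mathbb{S}\}\subseteq\rho_S(T)$, and that there exists $M\ge 0$ such that $$\|Q_s^{-1}(T)\|\le\frac{M}{|s|^2}\quad\text{and}\quad\|TQ_s^{-1}(T)\|\le\frac{M}{|s|},\qquad s\in S_\omega.$$ Then for all $n,k,m\in\mathbb{N}_0$ with $n<k<m$ there holds $$D(T^k)\in J_{\frac{k-n}{m-n}}\big(D(T^n),D(T^m)\big),$$ i.e. there exists some $C_{n,k,m}\ge 0$ such that $$\|x\|_{D(T^k)}\le C_{n,k,m}\,\|x\|_{D(T^n)}^{\frac{m-k}{m-n}}\,\|x\|_{D(T^m)}^{\frac{k-n}{m-n}},\qquad x\in D(T^m).$$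
   Context: Quaternions: $\mathbb{H}$ denotes the quaternions $s=s_0+s_1e_1+s_2e_2+s_3e_3$ with $\mathrm{Re}(s)=s_0$ and modulus $|s|=\sqrt{s_0^2+s_1^2+s_2^2+s_3^2}$; $\mathbb{S}:=\{s\in\mathbb{H}\mid s_0=0,\ |s|=1\}$ is the sphere of imaginary units, and $e^{i\omega}:=\cos\omega+i\sin\omega$ for $i\in\mathbb{S}$. Right quaternionic Banach space: a right vector space $X$ over $\mathbb{H}$ (scalar multiplication from the right) with a norm satisfying $\|xs\|=\|x\||s|$ for $x\in X,s\in\mathbb{H}$, the triangle inequality and definiteness, complete with respect to this norm. Operators: a right linear operator $T:D(T)\subseteq X\to X$ is defined on a right linear subspace $D(T)$ (not assumed dense) and satisfies $T(x+y)=Tx+Ty$, $T(xs)=(Tx)s$ for $x,y\in D(T)$, $s\in\mathbb{H}$. For real $\lambda$, $(\lambda T)(x):=(T\lambda)(x):=T(x)\lambda$ with domain $D(T)$. $T$ is closed if $D(T)$ is complete with respect to $\|x\|_{D(T)}:=\|x\|+\|Tx\|$. $\mathcal{B}(X)$ denotes the everywhere defined bounded right linear operators on $X$. Powers $T^n$ have their natural domains, with $T^0=I$, $D(T^0)=X$; $D(T^n)$ carries the norm $\|x\|_{D(T^n)}:=\|x\|+\|T^nx\|$. $S$-spectrum: for $s\in\mathbb{H}$, $Q_s(T):=T^2-2s_0T+|s|^2$ with $D(Q_s(T)):=D(T^2)$. The $S$-resolvent set is $\rho_S(T):=\{s\in\mathbb{H}\mid Q_s^{-1}(T)\in\mathcal{B}(X)\}$,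 i.e. $Q_s(T):D(T^2)\to X$ is bijective with bounded inverse $Q_s^{-1}(T)$. Intermediate spaces: $V\hookrightarrow W$ means $V\subseteq W$ and there is $C\ge0$ with $\|v\|_W\le C\|v\|_V$ for all $v\in V$. Two right Banach spaces $Y_0,Y_1$ form an interpolation couple if both are continuously embedded in a common topological Hausdorff space; then $\|x\|_{Y_0\cap Y_1}:=\max\{\|x\|_{Y_0},\|x\|_{Y_1}\}$ and $\|x\|_{Y_0+Y_1}:=\inf\{\|a\|_{Y_0}+\|b\|_{Y_1}\mid x=a+b,\ a\in Y_0,\ b\in Y_1\}$. For $\theta\in(0,1)$ and a right Banach space $E$ with $Y_0\cap Y_1\hookrightarrow E\hookrightarrow Y_0+Y_1$, we say $E\in J_\theta(Y_0,Y_1)$ if there exists $C_J\ge0$ such that $\|x\|_E\le C_J\|x\|_{Y_0}^{1-\theta}\|x\|_{Y_1}^{\theta}$ for all $x\in Y_0\cap Y_1$. *)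

theory Defs
  imports "HOL-Analysis.Analysis"
begin

section \<open>Quaternions\<close>

datatype quat = Quat (qRe: real) (qIm1: real) (qIm2: real) (qIm3: real)

lemma quat_eq_iff:
  "x = y \<longleftrightarrow> qRe x = qRe y \<and> qIm1 x = qIm1 y \<and> qIm2 x = qIm2 y \<and> qIm3 x = qIm3 y"
  by (cases x; cases y) simp

instantiation quat :: real_algebra_1
begin

definition zero_quat :: quat where "0 = Quat 0 0 0 0"

definition one_quat :: quat where "1 = Quat 1 0 0 0"

definition plus_quat :: "quat \<Rightarrow> quat \<Rightarrow> quat" where
  "x + y = Quat (qRe x + qRe y) (qIm1 x + qIm1 y) (qIm2 x + qIm2 y) (qIm3 x + qIm3 y)"

definition minus_quat :: "quat \<Rightarrow> quat \<Rightarrow> quat" where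
  "x - y = Quat (qRe x - qRe y) (qIm1 x - qIm1 y) (qIm2 x - qIm2 y) (qIm3 x - qIm3 y)"

definition uminus_quat :: "quat \<Rightarrow> quat" where
  "- x = Quat (- qRe x) (- qIm1 x) (- qIm2 x) (- qIm3 x)"

definition scaleR_quat :: "real \<Rightarrow> quat \<Rightarrow> quat" where
  "r *\<^sub>R x = Quat (r * qRe x) (r * qIm1 x) (r * qIm2 x) (r * qIm3 x)"

definition times_quat :: "quat \<Rightarrow> quat \<Rightarrow> quat" where
  "x * y = Quat
     (qRe x * qRe y - qIm1 x * qIm1 y - qIm2 x * qIm2 y - qIm3 x * qIm3 y)
     (qRe x * qIm1 y + qIm1 x * qRe y + qIm2 x * qIm3 y - qIm3 x * qIm2 y)
     (qRe x * qIm2 y - qIm1 x * qIm3 y + qIm2 x * qRe y + qIm3 x * qIm1 y)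
     (qRe x * qIm3 y + qIm1 x * qIm2 y - qIm2 x * qIm1 y + qIm3 x * qRe y)"

instance
  by standard
    (simp_all add: quat_eq_iff zero_quat_def one_quat_def plus_quat_def minus_quat_def
      uminus_quat_def scaleR_quat_def times_quat_def algebra_simps)

end

lemma quat_sel_simps [simp]:
  "qRe 0 = 0" "qIm1 0 = 0" "qIm2 0 = 0" "qIm3 0 = 0"
  "qRe 1 = 1" "qIm1 1 = 0" "qIm2 1 = 0" "qIm3 1 = 0"
  "qRe (x + y) = qRe x + qRe y" "qIm1 (x + y) = qIm1 x + qIm1 y"
  "qIm2 (x + y) = qIm2 x + qIm2 y" "qIm3 (x + y) = qIm3 x + qIm3 y"
  "qRe (x - y) = qRe x - qRe y" "qIm1 (x - y) = qIm1 x - qIm1 y"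
  "qIm2 (x - y) = qIm2 x - qIm2 y" "qIm3 (x - y) = qIm3 x - qIm3 y"
  "qRe (- x) = - qRe x" "qIm1 (- x) = - qIm1 x" "qIm2 (- x) = - qIm2 x" "qIm3 (- x) = - qIm3 x"
  "qRe (r *\<^sub>R x) = r * qRe x" "qIm1 (r *\<^sub>R x) = r * qIm1 x"
  "qIm2 (r *\<^sub>R x) = r * qIm2 x" "qIm3 (r *\<^sub>R x) = r * qIm3 x"
  by (simp_all add: zero_quat_def one_quat_def plus_quat_def minus_quat_def uminus_quat_def
      scaleR_quat_def)

instantiation quat :: real_normed_algebra_1
begin

definition norm_quat :: "quat \<Rightarrow> real" where
  "norm s = sqrt ((qRe s)\<^sup>2 + (qIm1 s)\<^sup>2 + (qIm2 s)\<^sup>2 + (qIm3 s)\<^sup>2)"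

definition sgn_quat :: "quat \<Rightarrow> quat" where "sgn (x::quat) = inverse (norm x) *\<^sub>R x"

definition dist_quat :: "quat \<Rightarrow> quat \<Rightarrow> real" where "dist (x::quat) y = norm (x - y)"

definition uniformity_quat :: "(quat \<times> quat) filter" where
  "uniformity = (INF e\<in>{0<..}. principal {(x :: quat, y). dist x y < e})"

definition open_quat :: "quat set \<Rightarrow> bool" where
  "open (U :: quat set) \<longleftrightarrow> (\<forall>x\<in>U. \<forall>\<^sub>F (x', y) in uniformity. x' = x \<longrightarrow> y \<in> U)"

instance
proof
  fix x y :: quat and r :: real
  show "(norm x = 0) = (x = 0)"
    by (simp add: norm_quat_def quat_eq_iff add_nonneg_eq_0_iff)
  have pair: "norm q = norm ((qRe q, qIm1 q), (qIm2 q, qIm3 q))" for q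
    by (simp add: norm_quat_def norm_prod_def)
  show "norm (x + y) \<le> norm x + norm y"
    using norm_triangle_ineq[of "((qRe x, qIm1 x), (qIm2 x, qIm3 x))"
        "((qRe y, qIm1 y), (qIm2 y, qIm3 y))"]
    by (simp add: pair)
  have "(qRe (r *\<^sub>R x))\<^sup>2 + (qIm1 (r *\<^sub>R x))\<^sup>2 + (qIm2 (r *\<^sub>R x))\<^sup>2 + (qIm3 (r *\<^sub>R x))\<^sup>2
      = r\<^sup>2 * ((qRe x)\<^sup>2 + (qIm1 x)\<^sup>2 + (qIm2 x)\<^sup>2 + (qIm3 x)\<^sup>2)"
    by (simp add: power_mult_distrib algebra_simps)
  then show "norm (r *\<^sub>R x) = \<bar>r\<bar> * norm x"
    by (simp only: norm_quat_def real_sqrt_mult real_sqrt_abs)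
  show "norm (x * y) \<le> norm x * norm y"
    unfolding norm_quat_def real_sqrt_mult[symmetric]
    by (rule eq_refl, rule arg_cong[where f = sqrt])
      (simp add: times_quat_def power2_eq_square algebra_simps)
  show "norm (1 :: quat) = 1"
    by (simp add: norm_quat_def)
qed (simp_all add: sgn_quat_def dist_quat_def uniformity_quat_def open_quat_def)

end

definition imaginary_units :: "quat set" where
  "imaginary_units = {s. qRe s = 0 \<and> norm s = 1}"

definition exp_iw :: "quat \<Rightarrow> real \<Rightarrow> quat" where
  "exp_iw i w = of_real (cos w) + i * of_real (sin w)"

definition S_ray :: "real \<Rightarrow> quat set" where
  "S_ray w = {of_real t * exp_iw i w | t i. t > 0 \<and> i \<in> imaginary_units}"


section \<open>Right quaternionic Banach spaces\<close>

class right_quaternionic_vector_space = ab_group_add +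
  fixes scaleQ :: "'a \<Rightarrow> quat \<Rightarrow> 'a"  (infixl \<open>*\<^sub>Q\<close> 75)
  assumes scaleQ_add_left: "(x + y) *\<^sub>Q s = x *\<^sub>Q s + y *\<^sub>Q s"
    and scaleQ_add_right: "x *\<^sub>Q (s + t) = x *\<^sub>Q s + x *\<^sub>Q t"
    and scaleQ_scaleQ: "x *\<^sub>Q (s * t) = (x *\<^sub>Q s) *\<^sub>Q t"
    and scaleQ_one: "x *\<^sub>Q 1 = x"

text \<open>The real scalar multiplication carried by \<^class>\<open>banach\<close> is no additional structure: it is
  the restriction of the quaternionic one to real scalars.\<close>

class right_quaternionic_banach = right_quaternionic_vector_space + banach +
  assumes norm_scaleQ: "norm (x *\<^sub>Q s) = norm x * norm s"
    and scaleR_eq_scaleQ: "r *\<^sub>R x = x *\<^sub>Q of_real r"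

text \<open>The quaternions themselves are a right quaternionic Banach space.\<close>

instantiation quat :: right_quaternionic_banach
begin

definition scaleQ_quat :: "quat \<Rightarrow> quat \<Rightarrow> quat" where "(x::quat) *\<^sub>Q s = x * s"

instance
proof
  fix x y s t :: quat and r :: real
  show "norm (x *\<^sub>Q s) = norm x * norm s"
    unfolding norm_quat_def real_sqrt_mult[symmetric] scaleQ_quat_def
    by (rule arg_cong[where f = sqrt])
      (simp add: times_quat_def power2_eq_square algebra_simps)
next
  fix X :: "nat \<Rightarrow> quat"
  assume "Cauchy X"
  have pair: "norm q = norm ((qRe q, qIm1 q), (qIm2 q, qIm3 q))" for q
    by (simp add: norm_quat_def norm_prod_def)
  let ?f = "\<lambda>j. ((qRe (X j), qIm1 (X j)), (qIm2 (X j), qIm3 (X j)))"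
  have "dist (?f i) (?f j) = dist (X i) (X j)" for i j
    by (simp only: dist_norm pair diff_Pair quat_sel_simps)
  then have "Cauchy ?f"
    using \<open>Cauchy X\<close> by (simp add: Cauchy_def)
  then have "convergent ?f"
    by (rule Cauchy_convergent)
  then obtain l where "?f \<longlonglongrightarrow> l"
    unfolding convergent_def ..
  moreover obtain a b c d where "l = ((a, b), (c, d))"
    by (cases l) auto
  ultimately have lim: "?f \<longlonglongrightarrow> ((a, b), (c, d))"
    by simp
  have "dist (X j) (Quat a b c d) = dist (?f j) ((a, b), (c, d))" for j
    by (simp only: dist_norm pair diff_Pair quat_sel_simps quat.sel)
  then have "X \<longlonglongrightarrow> Quat a b c d"
    using lim by (simp add: tendsto_iff)
  then show "convergent X"
    by (rule convergentI)
qed (simp_all only: scaleQ_quat_def distrib_left distrib_right mult.assoc mult_1_right of_real_def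
    mult_scaleR_right)

end

definition right_subspace :: "'a::right_quaternionic_vector_space set \<Rightarrow> bool" where
  "right_subspace V \<longleftrightarrow>
     0 \<in> V \<and> (\<forall>x\<in>V. \<forall>y\<in>V. x + y \<in> V) \<and> (\<forall>x\<in>V. \<forall>s. x *\<^sub>Q s \<in> V)"

definition complete_wrt :: "'a::ab_group_add set \<Rightarrow> ('a \<Rightarrow> real) \<Rightarrow> bool" where
  "complete_wrt V N \<longleftrightarrow>
     (\<forall>f :: nat \<Rightarrow> 'a. (\<forall>j. f j \<in> V) \<and> (\<forall>e>0. \<exists>K. \<forall>i\<ge>K. \<forall>j\<ge>K. N (f i - f j) < e) \<longrightarrow>
        (\<exists>x\<in>V. (\<lambda>j. N (f j - x)) \<longlonglongrightarrow> 0))"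

text \<open>Intermediate spaces are subsets of one ambient right vector space with their own norms; the
  values of the norm function outside the carrier are irrelevant.\<close>

datatype 'a nspace = NSpace (carr: "'a set") (nrm: "'a \<Rightarrow> real")

definition right_banach_space :: "'a::right_quaternionic_vector_space nspace \<Rightarrow> bool" where
  "right_banach_space Y \<longleftrightarrow>
     right_subspace (carr Y) \<and>
     (\<forall>x\<in>carr Y. nrm Y x \<ge> 0 \<and> (nrm Y x = 0 \<longrightarrow> x = 0)) \<and>
     (\<forall>x\<in>carr Y. \<forall>s. nrm Y (x *\<^sub>Q s) = nrm Y x * norm s) \<and>
     (\<forall>x\<in>carr Y. \<forall>y\<in>carr Y. nrm Y (x + y) \<le> nrm Y x + nrm Y y) \<and>
     complete_wrt (carr Y) (nrm Y)"


section \<open>Intermediate spaces\<close>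

definition cont_embedded :: "'a nspace \<Rightarrow> 'a nspace \<Rightarrow> bool"  (infix \<open>\<hookrightarrow>\<close> 50) where
  "V \<hookrightarrow> W \<longleftrightarrow> carr V \<subseteq> carr W \<and> (\<exists>C\<ge>0. \<forall>v\<in>carr V. nrm W v \<le> C * nrm V v)"

definition norm_topology :: "'a::ab_group_add nspace \<Rightarrow> 'a topology" where
  "norm_topology Y = topology (\<lambda>U. U \<subseteq> carr Y \<and>
     (\<forall>x\<in>U. \<exists>e>0. \<forall>y\<in>carr Y. nrm Y (y - x) < e \<longrightarrow> y \<in> U))"

lemma openin_norm_topology:
  "openin (norm_topology Y) U \<longleftrightarrow>
     U \<subseteq> carr Y \<and> (\<forall>x\<in>U. \<exists>e>0. \<forall>y\<in>carr Y. nrm Y (y - x) < e \<longrightarrow> y \<in> U)"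
proof -
  have "istopology (\<lambda>U. U \<subseteq> carr Y \<and>
     (\<forall>x\<in>U. \<exists>e>0. \<forall>y\<in>carr Y. nrm Y (y - x) < e \<longrightarrow> y \<in> U))" (is "istopology ?P")
    unfolding istopology_def
  proof (intro conjI allI impI)
    fix S T assume S: "?P S" and T: "?P T"
    show "S \<inter> T \<subseteq> carr Y" using S by blast
    show "\<forall>x\<in>S \<inter> T. \<exists>e>0. \<forall>y\<in>carr Y. nrm Y (y - x) < e \<longrightarrow> y \<in> S \<inter> T"
    proof
      fix x assume x: "x \<in> S \<inter> T"
      obtain d where "d > 0" "\<forall>y\<in>carr Y. nrm Y (y - x) < d \<longrightarrow> y \<in> S" using S x by blast
      moreover obtain e where "e > 0" "\<forall>y\<in>carr Y. nrm Y (y - x) < e \<longrightarrow> y \<in> T" using T x by blast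
      ultimately show "\<exists>e>0. \<forall>y\<in>carr Y. nrm Y (y - x) < e \<longrightarrow> y \<in> S \<inter> T"
        by (intro exI[of _ "min d e"]) auto
    qed
  next
    fix K assume K: "\<forall>U\<in>K. ?P U"
    then show "\<Union>K \<subseteq> carr Y" by blast
    show "\<forall>x\<in>\<Union>K. \<exists>e>0. \<forall>y\<in>carr Y. nrm Y (y - x) < e \<longrightarrow> y \<in> \<Union>K"
      using K by (meson UnionE UnionI)
  qed
  then show ?thesis
    by (simp add: norm_topology_def topology_inverse')
qed

definition interpolation_couple :: "'a::ab_group_add nspace \<Rightarrow> 'a nspace \<Rightarrow> bool" where
  "interpolation_couple Y0 Y1 \<longleftrightarrow>
     (\<exists>Z :: 'a topology. Hausdorff_space Z \<and>
        continuous_map (norm_topology Y0) Z id \<and> continuous_map (norm_topology Y1) Z id)"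

definition inter_space :: "'a nspace \<Rightarrow> 'a nspace \<Rightarrow> 'a nspace" where
  "inter_space Y0 Y1 = NSpace (carr Y0 \<inter> carr Y1) (\<lambda>x. max (nrm Y0 x) (nrm Y1 x))"

definition sum_space :: "'a::ab_group_add nspace \<Rightarrow> 'a nspace \<Rightarrow> 'a nspace" where
  "sum_space Y0 Y1 = NSpace {a + b | a b. a \<in> carr Y0 \<and> b \<in> carr Y1}
     (\<lambda>x. Inf {nrm Y0 a + nrm Y1 b | a b. x = a + b \<and> a \<in> carr Y0 \<and> b \<in> carr Y1})"

text \<open>The class is only meaningful for \<open>0 < \<theta> < 1\<close> and an interpolation couple of right Banach
  spaces; these requirements are part of the membership condition.\<close>

definition J_class ::
  "real \<Rightarrow> 'a::right_quaternionic_vector_space nspace \<Rightarrow> 'a nspace \<Rightarrow> 'a nspace set" where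
  "J_class \<theta> Y0 Y1 = {E.
     0 < \<theta> \<and> \<theta> < 1 \<and>
     right_banach_space Y0 \<and> right_banach_space Y1 \<and> interpolation_couple Y0 Y1 \<and>
     right_banach_space E \<and> inter_space Y0 Y1 \<hookrightarrow> E \<and> E \<hookrightarrow> sum_space Y0 Y1 \<and>
     (\<exists>C\<ge>0. \<forall>x\<in>carr Y0 \<inter> carr Y1.
        nrm E x \<le> C * nrm Y0 x powr (1 - \<theta>) * nrm Y1 x powr \<theta>)}"


section \<open>Operators and the S-spectrum\<close>

text \<open>An operator \<open>T : D(T) \<subseteq> X \<rightarrow> X\<close> is a pair of arguments \<open>D\<close>, \<open>T\<close>; the values of the total
  function \<open>T\<close> outside \<open>D\<close> are irrelevant.\<close>

definition right_linear_op ::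
  "'a::right_quaternionic_vector_space set \<Rightarrow> ('a \<Rightarrow> 'a) \<Rightarrow> bool" where
  "right_linear_op D T \<longleftrightarrow> right_subspace D \<and>
     (\<forall>x\<in>D. \<forall>y\<in>D. T (x + y) = T x + T y) \<and> (\<forall>x\<in>D. \<forall>s. T (x *\<^sub>Q s) = T x *\<^sub>Q s)"

definition closed_op :: "'a::real_normed_vector set \<Rightarrow> ('a \<Rightarrow> 'a) \<Rightarrow> bool" where
  "closed_op D T \<longleftrightarrow> complete_wrt D (\<lambda>x. norm x + norm (T x))"

definition bounded_right_linear :: "('a::right_quaternionic_banach \<Rightarrow> 'a) \<Rightarrow> bool" where
  "bounded_right_linear A \<longleftrightarrow> bounded_linear A \<and> (\<forall>x s. A (x *\<^sub>Q s) = A x *\<^sub>Q s)"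

primrec pow_dom :: "'a set \<Rightarrow> ('a \<Rightarrow> 'a) \<Rightarrow> nat \<Rightarrow> 'a set" where
  "pow_dom D T 0 = UNIV"
| "pow_dom D T (Suc n) = {x \<in> pow_dom D T n. (T ^^ n) x \<in> D}"

definition pow_dom_space :: "'a::real_normed_vector set \<Rightarrow> ('a \<Rightarrow> 'a) \<Rightarrow> nat \<Rightarrow> 'a nspace" where
  "pow_dom_space D T n = NSpace (pow_dom D T n) (\<lambda>x. norm x + norm ((T ^^ n) x))"

definition Q_op :: "('a::right_quaternionic_banach \<Rightarrow> 'a) \<Rightarrow> quat \<Rightarrow> 'a \<Rightarrow> 'a" where
  "Q_op T s x = (T ^^ 2) x - (2 * qRe s) *\<^sub>R T x + (norm s)\<^sup>2 *\<^sub>R x"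

definition Q_inv ::
  "'a::right_quaternionic_banach set \<Rightarrow> ('a \<Rightarrow> 'a) \<Rightarrow> quat \<Rightarrow> 'a \<Rightarrow> 'a" where
  "Q_inv D T s = inv_into (pow_dom D T 2) (Q_op T s)"

definition S_resolvent_set ::
  "'a::right_quaternionic_banach set \<Rightarrow> ('a \<Rightarrow> 'a) \<Rightarrow> quat set" where
  "S_resolvent_set D T =
     {s. bij_betw (Q_op T s) (pow_dom D T 2) UNIV \<and> bounded_right_linear (Q_inv D T s)}"

end

theory Submission
  imports Defs
begin

text \<open>For every \<open>t > 0\<close> the ray contains a point \<open>s\<close> with \<open>|s| = t\<close>. Writing
  \<open>Tx = T Q\<^sub>s\<^sup>-\<^sup>1 Q\<^sub>s x\<close> and moving one \<open>T\<close> past the resolvent turns the two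
  resolvent bounds into \<open>\<parallel>Tx\<parallel> \<le> (7M + 2) (t \<parallel>x\<parallel> + \<parallel>T\<^sup>2x\<parallel> / t)\<close> on \<open>D(T\<^sup>2)\<close>;
  optimising over \<open>t\<close> gives the Landau inequality \<open>\<parallel>Tx\<parallel>\<^sup>2 \<le> K \<parallel>x\<parallel> \<parallel>T\<^sup>2x\<parallel>\<close>.
  Hence \<open>j \<mapsto> \<parallel>T\<^sup>jx\<parallel>\<close> is log-convex up to a factor, which is the moment inequality; it also bounds
  the intermediate powers by the graph norm of \<open>T\<^sup>n\<close>, so that \<open>T\<^sup>n\<close> is closed and \<open>D(T\<^sup>n)\<close>
  is a Banach space.\<close>

section \<open>Real inequalities\<close>

text \<open>Optimisation over \<open>t\<close>. The value used is read off from \<open>c\<close>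
  rather than being the minimiser \<open>sqrt (b / a)\<close>, so that \<open>b = 0\<close> is no
  special case.\<close>

lemma square_le_of_scaled_bound:
  fixes a b c C :: real
  assumes "a > 0" and "C > 0" and "c \<ge> 0"
    and bound: "\<And>t. t > 0 \<Longrightarrow> c \<le> C * (t * a + b / t)"
    and "b \<ge> 0"
  shows "c\<^sup>2 \<le> 4 * C\<^sup>2 * a * b"
proof (cases "c = 0")
  case True
  then show ?thesis using assms by simp
next
  case False
  \<comment> \<open>With this \<open>t\<close> the summand \<open>C * t * a\<close> equals
    \<open>c / 2\<close> and is absorbed on the left.\<close>
  define t where "t = c / (2 * C * a)"
  have t: "t > 0" and c: "c = 2 * C * a * t"
    using assms False by (auto simp: t_def)
  have "c * t \<le> C * (t * a + b / t) * t"
    using bound[OF t] t by (simp add: mult_right_mono)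
  also have "\<dots> = C * (t * a * t + b)"
    using t by (simp add: field_simps)
  finally have "C * (a * t\<^sup>2) \<le> C * b"
    using c by (simp add: power2_eq_square algebra_simps)
  then have "a * t\<^sup>2 \<le> b" using \<open>C > 0\<close> by simp
  then have "(4 * C\<^sup>2 * a) * (a * t\<^sup>2) \<le> (4 * C\<^sup>2 * a) * b"
    using \<open>a > 0\<close> by (intro mult_left_mono) auto
  then show ?thesis by (simp add: c power2_eq_square algebra_simps)
qed

text \<open>Convexity makes the increments nondecreasing, so the increment at \<open>k\<close>
  separates the mean slope from \<open>n\<close> to \<open>k\<close> from the mean slope from
  \<open>k\<close> to \<open>m\<close>. The claim compares these slopes with denominators
  cleared.\<close>

lemma convex_seq_interpolation:
  fixes l :: "nat \<Rightarrow> real"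
  assumes conv: "\<And>j. n \<le> j \<Longrightarrow> j + 2 \<le> m \<Longrightarrow> 2 * l (Suc j) \<le> l j + l (j + 2)"
    and "n < k" and "k < m"
  shows "(real m - real k) * (l k - l n) \<le> (real k - real n) * (l m - l k)"
proof -
  define d where "d j = l (Suc j) - l j" for j
  have step: "d j \<le> d (Suc j)" if "n \<le> j" "j + 2 \<le> m" for j
    using conv[OF that] by (simp add: d_def)
  have mono: "d i \<le> d j" if "n \<le> i" "i \<le> j" "j < m" for i j
    using that(2,3)
  proof (induction j rule: dec_induct)
    case base
    then show ?case by simp
  next
    case (step j)
    then show ?case using \<open>n \<le> i\<close> \<open>\<And>j. n \<le> j \<Longrightarrow> j + 2 \<le> m \<Longrightarrow> d j \<le> d (Suc j)\<close>[of j] by simp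
  qed
  have "l k - l n = (\<Sum>j\<in>{n..<k}. d j)"
    unfolding d_def using sum_Suc_diff'[of n k l] \<open>n < k\<close> by simp
  also have "\<dots> \<le> (\<Sum>j\<in>{n..<k}. d k)"
    using mono assms by (intro sum_mono) auto
  finally have 1: "l k - l n \<le> (real k - real n) * d k"
    using \<open>n < k\<close> by (simp add: of_nat_diff)
  have "(real m - real k) * d k = (\<Sum>j\<in>{k..<m}. d k)"
    using \<open>k < m\<close> by (simp add: of_nat_diff)
  also have "\<dots> \<le> (\<Sum>j\<in>{k..<m}. d j)"
    using mono assms by (intro sum_mono) auto
  also have "\<dots> = l m - l k"
    unfolding d_def using sum_Suc_diff'[of k m l] \<open>k < m\<close> by simp
  finally have 2: "(real m - real k) * d k \<le> l m - l k" .
  have "(real m - real k) * (l k - l n) \<le> (real m - real k) * ((real k - real n) * d k)"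
    using 1 \<open>k < m\<close> by (intro mult_left_mono) auto
  also have "\<dots> = (real k - real n) * ((real m - real k) * d k)"
    by simp
  also have "\<dots> \<le> (real k - real n) * (l m - l k)"
    using 2 \<open>n < k\<close> by (intro mult_left_mono) auto
  finally show ?thesis .
qed

text \<open>Logarithms reduce this to \<open>convex_seq_interpolation\<close>, once vanishing terms
  have been excluded.\<close>

lemma log_convex_seq_interpolation:
  fixes b :: "nat \<Rightarrow> real"
  assumes nonneg: "\<And>j. b j \<ge> 0"
    and conv: "\<And>j. n \<le> j \<Longrightarrow> j + 2 \<le> m \<Longrightarrow> (b (Suc j))\<^sup>2 \<le> b j * b (j + 2)"
    and "n < k" and "k < m"
  shows "b k \<le> b n powr ((real m - real k) / (real m - real n))
              * b m powr ((real k - real n) / (real m - real n))"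
proof (cases "b k = 0")
  case True
  then show ?thesis by simp
next
  case False
  \<comment> \<open>A zero on either side of \<open>k\<close> would propagate along the convexity
    inequality to \<open>k\<close> itself. Hence \<open>b k \<noteq> 0\<close> makes every term from
    \<open>n\<close> to \<open>m\<close> positive.\<close>
  have up: "b (Suc j) = 0" if "b j = 0" "n \<le> j" "j + 2 \<le> m" for j
    using conv[OF that(2,3)] that(1) by simp
  have down: "b (Suc j) = 0" if "b (j + 2) = 0" "n \<le> j" "j + 2 \<le> m" for j
    using conv[OF that(2,3)] that(1) by simp
  have lower: "b j \<noteq> 0" if "n \<le> j" "j \<le> k" for j
  proof
    assume "b j = 0"
    have "b i = 0" if "j \<le> i" "i \<le> k" for i
      using that
    proof (induction i rule: dec_induct)
      case base
      then show ?case by (simp add: \<open>b j = 0\<close>)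
    next
      case (step i)
      then show ?case using up[of i] \<open>n \<le> j\<close> \<open>k < m\<close> by simp
    qed
    then show False using that False by blast
  qed
  have upper: "b j \<noteq> 0" if "k \<le> j" "j \<le> m" for j
  proof
    assume "b j = 0"
    have "b i = 0" if "i \<le> j" "k \<le> i" for i
      using that
    proof (induction i rule: inc_induct)
      case base
      then show ?case by (simp add: \<open>b j = 0\<close>)
    next
      case (step i)
      then show ?case using down[of "i - 1"] \<open>j \<le> m\<close> \<open>n < k\<close> by (cases i) auto
    qed
    then show False using that False by blast
  qed
  have pos: "b j > 0" if "n \<le> j" "j \<le> m" for j
    using lower[of j] upper[of j] nonneg[of j] that by (cases "j \<le> k") auto
  define l where "l j = ln (b j)" for j
  have "2 * l (Suc j) \<le> l j + l (j + 2)" if "n \<le> j" "j + 2 \<le> m" for j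
  proof -
    have p: "b j > 0" "b (Suc j) > 0" "b (j + 2) > 0"
      using pos that by auto
    have "ln ((b (Suc j))\<^sup>2) \<le> ln (b j * b (j + 2))"
      using p conv[OF that] by simp
    then show ?thesis
      using p by (simp add: l_def ln_mult ln_realpow)
  qed
  from convex_seq_interpolation[of n m l, OF this \<open>n < k\<close> \<open>k < m\<close>]
  have "l k * (real m - real n) \<le> (real m - real k) * l n + (real k - real n) * l m"
    by (simp add: algebra_simps)
  then have "l k \<le> ((real m - real k) * l n + (real k - real n) * l m) / (real m - real n)"
    using assms by (simp add: pos_le_divide_eq)
  then have "exp (l k) \<le> exp ((real m - real k) / (real m - real n) * l n
      + (real k - real n) / (real m - real n) * l m)"
    by (simp add: add_divide_distrib)
  then show ?thesis
    using pos[of n] pos[of k] pos[of m] assms by (simp add: exp_add l_def powr_def)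
qed

text \<open>The constant is produced before the sequence is chosen, because it has to serve the
  sequences \<open>norm ((T ^^ j) x)\<close> for all \<open>x\<close> at once.\<close>

lemma almost_log_convex_seq_interpolation:
  fixes K :: real
  assumes "K > 0" and "n < k" and "k < m"
  obtains C where "C \<ge> 0"
    and "\<And>a :: nat \<Rightarrow> real. \<lbrakk>\<And>j. a j \<ge> 0; \<And>j. j + 2 \<le> m \<Longrightarrow> (a (Suc j))\<^sup>2 \<le> K * a j * a (j + 2)\<rbrakk> \<Longrightarrow>
      a k \<le> C * a n powr ((real m - real k) / (real m - real n))
              * a m powr ((real k - real n) / (real m - real n))"
proof -
  define c where "c = sqrt K"
  define \<alpha> where "\<alpha> = (real m - real k) / (real m - real n)"
  define \<beta> where "\<beta> = (real k - real n) / (real m - real n)"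
  \<comment> \<open>Collects the weights \<open>c ^ j\<^sup>2\<close> at \<open>n\<close>,
    \<open>m\<close> and \<open>k\<close> that remain when the inequality for the weighted sequence
    is rewritten for \<open>a\<close>.\<close>
  define C where "C = (c ^ n\<^sup>2) powr \<alpha> * (c ^ m\<^sup>2) powr \<beta> / c ^ k\<^sup>2"
  have c: "c > 0" "c\<^sup>2 = K" using \<open>K > 0\<close> by (auto simp: c_def)
  have "a k \<le> C * a n powr \<alpha> * a m powr \<beta>"
    if nn: "\<And>j. a j \<ge> 0"
      and conv: "\<And>j. j + 2 \<le> m \<Longrightarrow> (a (Suc j))\<^sup>2 \<le> K * a j * a (j + 2)" for a :: "nat \<Rightarrow> real"
  proof -
    \<comment> \<open>The weights \<open>c ^ j\<^sup>2\<close> have constant second ratio \<open>c\<^sup>2 = K\<close>, which absorbs the factor.\<close>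
    define b where "b j = a j * c ^ j\<^sup>2" for j
    have "b k \<le> b n powr ((real m - real k) / (real m - real n))
              * b m powr ((real k - real n) / (real m - real n))"
    proof (rule log_convex_seq_interpolation)
      show "b j \<ge> 0" for j using nn c by (simp add: b_def)
      show "(b (Suc j))\<^sup>2 \<le> b j * b (j + 2)" if "j + 2 \<le> m" for j
      proof -
        have e1: "(c ^ (Suc j)\<^sup>2)\<^sup>2 = c ^ (2 * j\<^sup>2 + 4 * j + 2)"
          unfolding power_mult[symmetric] by (rule arg_cong[where f = "power c"])
            (simp add: power2_eq_square algebra_simps)
        have e2: "c ^ j\<^sup>2 * c ^ (j + 2)\<^sup>2 = c ^ (2 * j\<^sup>2 + 4 * j + 2) * c\<^sup>2"
          unfolding power_add[symmetric] by (rule arg_cong[where f = "power c"])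
            (simp add: power2_eq_square algebra_simps)
        have "(b (Suc j))\<^sup>2 = (a (Suc j))\<^sup>2 * c ^ (2 * j\<^sup>2 + 4 * j + 2)"
          unfolding b_def power_mult_distrib e1 ..
        also have "\<dots> \<le> (K * a j * a (j + 2)) * c ^ (2 * j\<^sup>2 + 4 * j + 2)"
          using conv[OF that] c by (intro mult_right_mono) auto
        also have "\<dots> = a j * a (j + 2) * (c ^ (2 * j\<^sup>2 + 4 * j + 2) * c\<^sup>2)"
          using c by simp
        also have "\<dots> = b j * b (j + 2)"
          unfolding b_def e2[symmetric] by simp
        finally show ?thesis .
      qed
    qed (use assms in auto)
    then have "a k * c ^ k\<^sup>2 \<le> (a n * c ^ n\<^sup>2) powr \<alpha> * (a m * c ^ m\<^sup>2) powr \<beta>"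
      by (simp add: b_def \<alpha>_def \<beta>_def)
    also have "\<dots> = C * a n powr \<alpha> * a m powr \<beta> * c ^ k\<^sup>2"
      using nn c by (simp add: C_def powr_mult)
    finally show ?thesis using c by simp
  qed
  moreover have "C \<ge> 0" using c by (simp add: C_def)
  ultimately show ?thesis using that unfolding \<alpha>_def \<beta>_def by blast
qed


section \<open>Powers of right linear operators\<close>

lemma norm_scaleQ_quat: "norm (s * t) = norm s * norm (t :: quat)"
  using norm_scaleQ[of s t] by (simp add: scaleQ_quat_def)

lemma abs_qRe_le_norm: "\<bar>qRe s\<bar> \<le> norm s"
  unfolding norm_quat_def by (rule real_le_rsqrt) (simp add: add_nonneg_nonneg)

text \<open>The unit \<open>e_1\<close> provides one point of modulus 1 in the direction \<omega>;
  multiplicativity of the norm turns scaling by \<open>t\<close> into modulus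
  \<open>t\<close>.\<close>

lemma S_ray_norm_surj:
  assumes "t > 0"
  obtains s where "s \<in> S_ray \<omega>" and "norm s = t"
proof
  let ?i = "Quat 0 1 0 0"
  have i: "?i \<in> imaginary_units"
    by (simp add: imaginary_units_def norm_quat_def)
  then show "of_real t * exp_iw ?i \<omega> \<in> S_ray \<omega>"
    using assms unfolding S_ray_def by blast
  have "exp_iw ?i \<omega> = Quat (cos \<omega>) (sin \<omega>) 0 0"
    by (simp add: exp_iw_def of_real_def times_quat_def quat_eq_iff)
  then have "norm (exp_iw ?i \<omega>) = 1"
    by (simp add: norm_quat_def)
  then show "norm (of_real t * exp_iw ?i \<omega>) = t"
    using assms by (simp add: norm_scaleQ_quat)
qed

section \<open>Domains of powers\<close>

lemma pow_dom_iff: "x \<in> pow_dom D T n \<longleftrightarrow> (\<forall>j<n. (T ^^ j) x \<in> D)"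
  by (induction n) (auto simp: less_Suc_eq)

lemma pow_dom_antimono: "x \<in> pow_dom D T n \<Longrightarrow> m \<le> n \<Longrightarrow> x \<in> pow_dom D T m"
  by (auto simp: pow_dom_iff)

lemma funpow_in_pow_dom:
  assumes "x \<in> pow_dom D T (j + i)"
  shows "(T ^^ j) x \<in> pow_dom D T i"
  unfolding pow_dom_iff
proof (intro allI impI)
  fix l assume "l < i"
  then have "(T ^^ (l + j)) x \<in> D" using assms by (simp add: pow_dom_iff)
  then show "(T ^^ l) ((T ^^ j) x) \<in> D" by (simp add: funpow_add)
qed

lemma funpow_two: "(T ^^ 2) x = T (T x)"
  by (simp add: numeral_2_eq_2)

lemma pow_dom_two: "x \<in> pow_dom D T 2 \<longleftrightarrow> x \<in> D \<and> T x \<in> D"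
  by (auto simp: numeral_2_eq_2)

lemma scaleQ_zero_right: "(x :: 'a::right_quaternionic_vector_space) *\<^sub>Q 0 = 0"
  using scaleQ_add_right[of x 0 0] by simp

locale right_linear_operator =
  fixes D :: "'x::right_quaternionic_banach set" and T :: "'x \<Rightarrow> 'x"
  assumes right_linear: "right_linear_op D T"
begin

lemma add_dom: "x \<in> D \<Longrightarrow> y \<in> D \<Longrightarrow> x + y \<in> D"
  and scaleQ_dom: "x \<in> D \<Longrightarrow> x *\<^sub>Q s \<in> D"
  and zero_dom: "0 \<in> D"
  and add: "x \<in> D \<Longrightarrow> y \<in> D \<Longrightarrow> T (x + y) = T x + T y"
  and scaleQ: "x \<in> D \<Longrightarrow> T (x *\<^sub>Q s) = T x *\<^sub>Q s"
  using right_linear by (auto simp: right_linear_op_def right_subspace_def)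

lemma zero: "T 0 = 0"
  using scaleQ[OF zero_dom, of 0] by (simp add: scaleQ_zero_right)

lemma scaleR_dom: "x \<in> D \<Longrightarrow> r *\<^sub>R x \<in> D"
  and scaleR: "x \<in> D \<Longrightarrow> T (r *\<^sub>R x) = r *\<^sub>R T x"
  by (simp_all add: scaleR_eq_scaleQ scaleQ_dom scaleQ)

lemma diff_dom: "x \<in> D \<Longrightarrow> y \<in> D \<Longrightarrow> x - y \<in> D"
  using add_dom[OF _ scaleR_dom, of x y "-1"] by simp

lemma diff: "x \<in> D \<Longrightarrow> y \<in> D \<Longrightarrow> T (x - y) = T x - T y"
  using add[OF _ scaleR_dom, of x y "-1"] scaleR[of y "-1"] by simp

lemma funpow_zero: "(T ^^ n) 0 = 0"
  by (induction n) (auto simp: zero)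

lemma funpow_add_arg:
  "x \<in> pow_dom D T n \<Longrightarrow> y \<in> pow_dom D T n \<Longrightarrow> (T ^^ n) (x + y) = (T ^^ n) x + (T ^^ n) y"
  by (induction n) (auto simp: add)

lemma funpow_scaleQ: "x \<in> pow_dom D T n \<Longrightarrow> (T ^^ n) (x *\<^sub>Q s) = (T ^^ n) x *\<^sub>Q s"
  by (induction n) (auto simp: scaleQ)

text \<open>Allows the locale to be interpreted for \<open>T ^^ n\<close> in its turn, so that facts
  such as \<open>diff\<close> carry over without a new induction.\<close>

lemma right_linear_op_funpow: "right_linear_op (pow_dom D T n) (T ^^ n)"
proof -
  have mono: "x \<in> pow_dom D T j" if "x \<in> pow_dom D T n" "j < n" for x j
    using pow_dom_antimono[OF that(1)] that(2) by simp
  have "(T ^^ j) (x + y) \<in> D" if "x \<in> pow_dom D T n" "y \<in> pow_dom D T n" "j < n" for x y j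
    using that funpow_add_arg[of x j y] mono add_dom by (auto simp: pow_dom_iff)
  moreover have "(T ^^ j) (x *\<^sub>Q s) \<in> D" if "x \<in> pow_dom D T n" "j < n" for x s j
    using that funpow_scaleQ[of x j s] mono scaleQ_dom by (auto simp: pow_dom_iff)
  moreover have "0 \<in> pow_dom D T n"
    by (simp add: pow_dom_iff funpow_zero zero_dom)
  ultimately show ?thesis
    unfolding right_linear_op_def right_subspace_def
    by (auto simp: funpow_add_arg funpow_scaleQ) (auto simp: pow_dom_iff)
qed

lemma funpow_diff:
  assumes "x \<in> pow_dom D T n" and "y \<in> pow_dom D T n"
  shows "(T ^^ n) (x - y) = (T ^^ n) x - (T ^^ n) y" and "x - y \<in> pow_dom D T n"
proof -
  interpret P: right_linear_operator "pow_dom D T n" "T ^^ n"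
    by standard (rule right_linear_op_funpow)
  show "(T ^^ n) (x - y) = (T ^^ n) x - (T ^^ n) y" "x - y \<in> pow_dom D T n"
    using P.diff P.diff_dom assms by auto
qed

section \<open>The inverse of \<open>Q_op\<close> and the resolvent estimate\<close>

lemma resolvent:
  assumes "s \<in> S_resolvent_set D T"
  shows Q_inv_dom: "Q_inv D T s x \<in> D" "T (Q_inv D T s x) \<in> D"
    and Q_op_Q_inv: "T (T (Q_inv D T s x))
      = x + (2 * qRe s) *\<^sub>R T (Q_inv D T s x) - (norm s)\<^sup>2 *\<^sub>R Q_inv D T s x"
    and Q_inv_Q_op: "y \<in> D \<Longrightarrow> T y \<in> D \<Longrightarrow>
      Q_inv D T s (T (T y) - (2 * qRe s) *\<^sub>R T y + (norm s)\<^sup>2 *\<^sub>R y) = y"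
    and bounded_linear_Q_inv: "bounded_linear (Q_inv D T s)"
proof -
  have bij: "bij_betw (Q_op T s) (pow_dom D T 2) UNIV" and "bounded_right_linear (Q_inv D T s)"
    using assms by (auto simp: S_resolvent_set_def)
  then show "bounded_linear (Q_inv D T s)" by (simp add: bounded_right_linear_def)
  have surj: "x \<in> Q_op T s ` pow_dom D T 2" for x
    using bij by (simp add: bij_betw_def)
  from inv_into_into[OF surj, of x]
  show "Q_inv D T s x \<in> D" "T (Q_inv D T s x) \<in> D"
    by (auto simp: Q_inv_def pow_dom_two)
  have "Q_op T s (Q_inv D T s x) = x"
    unfolding Q_inv_def by (rule f_inv_into_f[OF surj])
  \<comment> \<open>\<open>Q_op\<close> solved for its leading term: \<open>T^2 Q_s^-1\<close> is
    expressed through operators for which bounds are available.\<close>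
  then show "T (T (Q_inv D T s x))
      = x + (2 * qRe s) *\<^sub>R T (Q_inv D T s x) - (norm s)\<^sup>2 *\<^sub>R Q_inv D T s x"
    by (simp add: Q_op_def funpow_two algebra_simps)
  assume "y \<in> D" "T y \<in> D"
  then have "Q_inv D T s (Q_op T s y) = y"
    unfolding Q_inv_def using bij
    by (intro inv_into_f_f) (auto simp: bij_betw_def pow_dom_two)
  then show "Q_inv D T s (T (T y) - (2 * qRe s) *\<^sub>R T y + (norm s)\<^sup>2 *\<^sub>R y) = y"
    by (simp add: Q_op_def funpow_two)
qed

text \<open>With \<open>y = Q_inv D T s x\<close>, applying \<open>T\<close> to
  \<open>Q_s y = x\<close> gives \<open>Q_s (T y) = T x\<close>, because \<open>T\<close> commutes
  with the real coefficients. Applying \<open>Q_inv D T s\<close> then gives the claim.\<close>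

lemma Q_inv_commute:
  assumes s: "s \<in> S_resolvent_set D T" and "x \<in> D"
  shows "Q_inv D T s (T x) = T (Q_inv D T s x)"
proof -
  let ?y = "Q_inv D T s x"
  note dom = Q_inv_dom[OF s, of x]
  have eq: "T (T ?y) = x + (2 * qRe s) *\<^sub>R T ?y - (norm s)\<^sup>2 *\<^sub>R ?y"
    by (rule Q_op_Q_inv[OF s])
  \<comment> \<open>Since \<open>x \<in> D\<close>, all terms on the right of \<open>eq\<close> lie
    in \<open>D\<close>; so \<open>T ?y\<close> is in the domain of \<open>Q_s\<close>.\<close>
  have TT: "T (T ?y) \<in> D"
    unfolding eq using assms dom by (intro diff_dom add_dom scaleR_dom)
  have "T (T (T ?y)) = T x + (2 * qRe s) *\<^sub>R T (T ?y) - (norm s)\<^sup>2 *\<^sub>R T ?y"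
    by (subst eq) (use assms dom in \<open>simp add: diff add scaleR add_dom scaleR_dom\<close>)
  then have "T (T (T ?y)) - (2 * qRe s) *\<^sub>R T (T ?y) + (norm s)\<^sup>2 *\<^sub>R T ?y = T x"
    by simp
  then show ?thesis
    using Q_inv_Q_op[OF s dom(2) TT] by simp
qed

text \<open>\<open>T Q_s^-1\<close> is applied to \<open>Q_s x\<close>. Estimated directly, the
  middle term would contribute \<open>2 * M * norm (T x)\<close>, which cannot be absorbed for large
  \<open>M\<close>; after commuting it contains \<open>T^2 Q_s^-1 x\<close>, which is controlled by
  \<open>norm x\<close>.\<close>

lemma norm_le_of_resolvent_bounds:
  assumes s: "s \<in> S_resolvent_set D T" and "norm s = t" and "t > 0"
    and R: "onorm (Q_inv D T s) \<le> M / t\<^sup>2"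
    and TR: "bounded_linear (\<lambda>y. T (Q_inv D T s y))" "onorm (\<lambda>y. T (Q_inv D T s y)) \<le> M / t"
    and x: "x \<in> pow_dom D T 2"
  shows "norm (T x) \<le> (7 * M + 2) * (t * norm x + norm (T (T x)) / t)"
proof -
  let ?R = "Q_inv D T s"
  have xD: "x \<in> D" "T x \<in> D" using x by (auto simp: pow_dom_two)
  interpret TR: bounded_linear "\<lambda>y. T (?R y)" by fact
  have nR: "norm (?R y) \<le> M / t\<^sup>2 * norm y" for y
    using onorm[OF bounded_linear_Q_inv[OF s], of y] R
    by (meson mult_right_mono norm_ge_zero order_trans)
  have nTR: "norm (T (?R y)) \<le> M / t * norm y" for y
    using onorm[OF TR(1), of y] TR(2) by (meson mult_right_mono norm_ge_zero order_trans)
  have "M \<ge> 0"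
    using onorm_pos_le[OF TR(1)] TR(2) \<open>t > 0\<close>
    by (metis dual_order.trans zero_le_divide_iff not_le)
  have re: "\<bar>qRe s\<bar> \<le> t" using abs_qRe_le_norm[of s] \<open>norm s = t\<close> by simp
  \<comment> \<open>The three terms contribute \<open>1\<close>, \<open>2 * M\<close> and
    \<open>M\<close>.\<close>
  have "norm (T (T (?R x))) \<le> norm x + norm ((2 * qRe s) *\<^sub>R T (?R x)) + norm (t\<^sup>2 *\<^sub>R ?R x)"
    unfolding Q_op_Q_inv[OF s] \<open>norm s = t\<close>
    by (meson add_right_mono norm_triangle_ineq norm_triangle_ineq4 order_trans)
  also have "\<dots> \<le> norm x + (2 * t) * (M / t * norm x) + t\<^sup>2 * (M / t\<^sup>2 * norm x)"
    unfolding norm_scaleR abs_mult using nR[of x] nTR[of x] re \<open>t > 0\<close>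
    by (intro add_mono order_refl mult_mono) simp_all
  also have "\<dots> = (1 + 3 * M) * norm x"
    using \<open>t > 0\<close> by (simp add: field_simps)
  finally have nTTR: "norm (T (T (?R x))) \<le> (1 + 3 * M) * norm x" .
  have "T x = T (?R (T (T x) - (2 * qRe s) *\<^sub>R T x + t\<^sup>2 *\<^sub>R x))"
    using Q_inv_Q_op[OF s xD] \<open>norm s = t\<close> by simp
  also have "\<dots> = T (?R (T (T x))) - (2 * qRe s) *\<^sub>R T (?R (T x)) + t\<^sup>2 *\<^sub>R T (?R x)"
    by (simp add: TR.add TR.diff TR.scaleR)
  also have "T (?R (T x)) = T (T (?R x))"
    using Q_inv_commute[OF s xD(1)] by simp
  finally have "norm (T x) = norm (T (?R (T (T x))) - (2 * qRe s) *\<^sub>R T (T (?R x)) + t\<^sup>2 *\<^sub>R T (?R x))"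
    by simp
  also have "\<dots> \<le> norm (T (?R (T (T x)))) + norm ((2 * qRe s) *\<^sub>R T (T (?R x)))
      + norm (t\<^sup>2 *\<^sub>R T (?R x))"
    by (meson add_right_mono norm_triangle_ineq norm_triangle_ineq4 order_trans)
  also have "\<dots> \<le> M / t * norm (T (T x)) + (2 * t) * ((1 + 3 * M) * norm x)
      + t\<^sup>2 * (M / t * norm x)"
    unfolding norm_scaleR abs_mult using nTR[of "T (T x)"] nTR[of x] nTTR re \<open>t > 0\<close>
    by (intro add_mono mult_mono) simp_all
  \<comment> \<open>The coefficient of \<open>t * norm x\<close> is
    \<open>2 * (1 + 3 * M) + M\<close>.\<close>
  also have "\<dots> = M * (norm (T (T x)) / t) + (7 * M + 2) * (t * norm x)"
    using \<open>t > 0\<close> by (simp add: field_simps power2_eq_square)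
  \<comment> \<open>\<open>M\<close> is enlarged to get one common factor, the form that
    \<open>square_le_of_scaled_bound\<close> takes.\<close>
  also have "\<dots> \<le> (7 * M + 2) * (norm (T (T x)) / t) + (7 * M + 2) * (t * norm x)"
    using \<open>M \<ge> 0\<close> \<open>t > 0\<close> by (intro add_mono mult_right_mono) auto
  finally show ?thesis by (simp add: algebra_simps)
qed

end

text \<open>Sequential form of closedness: completeness supplies a limit in the graph norm, and
  uniqueness of limits in the norm of the space identifies it with \<open>x\<close> and its image
  with \<open>y\<close>.\<close>

lemma closed_opD:
  fixes D :: "'x::right_quaternionic_banach set"
  assumes "right_linear_op D T" and closed: "closed_op D T"
    and f: "\<And>j. f j \<in> D" and lim: "f \<longlonglongrightarrow> x" "(\<lambda>j. T (f j)) \<longlonglongrightarrow> y"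
  shows "x \<in> D \<and> T x = y"
proof -
  interpret right_linear_operator D T by standard fact
  have "\<exists>K. \<forall>i\<ge>K. \<forall>j\<ge>K. norm (f i - f j) + norm (T (f i - f j)) < e" if "e > 0" for e :: real
  proof -
    have "e / 2 > 0" using that by simp
    obtain K1 where K1: "\<forall>i\<ge>K1. \<forall>j\<ge>K1. norm (f i - f j) < e / 2"
      using LIMSEQ_imp_Cauchy[OF lim(1)] \<open>e / 2 > 0\<close> unfolding Cauchy_iff by blast
    obtain K2 where K2: "\<forall>i\<ge>K2. \<forall>j\<ge>K2. norm (T (f i) - T (f j)) < e / 2"
      using LIMSEQ_imp_Cauchy[OF lim(2)] \<open>e / 2 > 0\<close> unfolding Cauchy_iff by blast
    have "norm (f i - f j) + norm (T (f i - f j)) < e"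
      if "i \<ge> max K1 K2" "j \<ge> max K1 K2" for i j
    proof -
      have "norm (f i - f j) < e / 2" "norm (T (f i) - T (f j)) < e / 2"
        using K1 K2 that by auto
      then show ?thesis using diff[OF f f, of i j] by simp
    qed
    then show ?thesis by blast
  qed
  then obtain z where z: "z \<in> D" "(\<lambda>j. norm (f j - z) + norm (T (f j - z))) \<longlonglongrightarrow> 0"
    using closed f unfolding closed_op_def complete_wrt_def by blast
  have "(\<lambda>j. norm (f j - z)) \<longlonglongrightarrow> 0"
    by (rule Lim_null_comparison[OF _ z(2)]) auto
  then have "f \<longlonglongrightarrow> z" using LIM_zero_iff tendsto_norm_zero_iff by blast
  then have "x = z" using lim(1) LIMSEQ_unique by blast
  have "(\<lambda>j. norm (T (f j) - T z)) \<longlonglongrightarrow> 0"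
    by (rule Lim_null_comparison[OF _ z(2)]) (use f z(1) diff in auto)
  then have "(\<lambda>j. T (f j)) \<longlonglongrightarrow> T z" using LIM_zero_iff tendsto_norm_zero_iff by blast
  then have "y = T z" using lim(2) LIMSEQ_unique by blast
  then show ?thesis using \<open>x = z\<close> z(1) by simp
qed


section \<open>Operators satisfying a Landau inequality\<close>

text \<open>Separates the spectral hypotheses from the rest: only the quadratic inequality is passed
  on, squared so that it matches the hypothesis of
  \<open>almost_log_convex_seq_interpolation\<close>.\<close>

locale landau_operator = right_linear_operator +
  fixes K :: real
  assumes closed: "closed_op D T"
    and K_pos: "K > 0"
    and landau: "x \<in> pow_dom D T 2 \<Longrightarrow> (norm (T x))\<^sup>2 \<le> K * norm x * norm (T (T x))"
begin

definition graph_norm :: "nat \<Rightarrow> 'a \<Rightarrow> real" where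
  "graph_norm n x = norm x + norm ((T ^^ n) x)"

lemma pow_dom_space_eq: "pow_dom_space D T n = NSpace (pow_dom D T n) (graph_norm n)"
  unfolding pow_dom_space_def graph_norm_def ..

lemma graph_norm_nonneg: "graph_norm n x \<ge> 0"
  by (simp add: graph_norm_def)

lemma norm_le_graph_norm: "norm x \<le> graph_norm n x"
  by (simp add: graph_norm_def)

lemma norm_funpow_le_graph_norm: "norm ((T ^^ n) x) \<le> graph_norm n x"
  by (simp add: graph_norm_def)

text \<open>The sequence \<open>norm ((T ^^ j) x)\<close> is log-convex up to the factor
  \<open>K\<close>. The extra summand \<open>norm x\<close> of the graph norm costs only 1 in the
  constant.\<close>

lemma moment_inequality:
  assumes "n < k" and "k < m"
  obtains C where "C \<ge> 0"
    and "\<And>x. x \<in> pow_dom D T m \<Longrightarrow>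
      graph_norm k x \<le> C * graph_norm n x powr ((real m - real k) / (real m - real n))
                        * graph_norm m x powr ((real k - real n) / (real m - real n))"
proof -
  define \<alpha> where "\<alpha> = (real m - real k) / (real m - real n)"
  define \<beta> where "\<beta> = (real k - real n) / (real m - real n)"
  have ab: "\<alpha> \<ge> 0" "\<beta> \<ge> 0" "\<alpha> + \<beta> = 1"
    using assms by (auto simp: \<alpha>_def \<beta>_def simp flip: add_divide_distrib)
  obtain C where C: "C \<ge> 0"
    "\<And>a :: nat \<Rightarrow> real. \<lbrakk>\<And>j. a j \<ge> 0; \<And>j. j + 2 \<le> m \<Longrightarrow> (a (Suc j))\<^sup>2 \<le> K * a j * a (j + 2)\<rbrakk> \<Longrightarrow>
      a k \<le> C * a n powr \<alpha> * a m powr \<beta>"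
    using almost_log_convex_seq_interpolation[OF K_pos assms] unfolding \<alpha>_def \<beta>_def by blast
  have "graph_norm k x \<le> (1 + C) * graph_norm n x powr \<alpha> * graph_norm m x powr \<beta>"
    if x: "x \<in> pow_dom D T m" for x
  proof -
    \<comment> \<open>The Landau inequality at the vector \<open>(T ^^ j) x\<close>.\<close>
    have "(norm ((T ^^ Suc j) x))\<^sup>2 \<le> K * norm ((T ^^ j) x) * norm ((T ^^ (j + 2)) x)"
      if "j + 2 \<le> m" for j
    proof -
      have "(T ^^ j) x \<in> pow_dom D T 2"
        by (rule funpow_in_pow_dom[OF pow_dom_antimono[OF x that]])
      from landau[OF this] show ?thesis by simp
    qed
    from C(2)[OF _ this]
    have "norm ((T ^^ k) x) \<le> C * norm ((T ^^ n) x) powr \<alpha> * norm ((T ^^ m) x) powr \<beta>"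
      by simp
    also have "\<dots> \<le> C * graph_norm n x powr \<alpha> * graph_norm m x powr \<beta>"
      using C(1) ab by (intro mult_mono powr_mono2 order_refl norm_funpow_le_graph_norm) auto
    finally have 1: "norm ((T ^^ k) x) \<le> C * graph_norm n x powr \<alpha> * graph_norm m x powr \<beta>" .
    \<comment> \<open>As the exponents add up to 1, \<open>norm x\<close> splits into two powers,
      one bounded by each graph norm.\<close>
    have "norm x = norm x powr \<alpha> * norm x powr \<beta>"
      using ab by (simp add: powr_add[symmetric])
    also have "\<dots> \<le> graph_norm n x powr \<alpha> * graph_norm m x powr \<beta>"
      using ab by (intro mult_mono powr_mono2 norm_le_graph_norm) auto
    finally show ?thesis
      using 1 unfolding graph_norm_def[of k] by (simp add: algebra_simps)
  qed
  then show ?thesis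
    using that[of "1 + C"] C(1) unfolding \<alpha>_def \<beta>_def by simp
qed

text \<open>The moment inequality with lower index 0 bounds intermediate powers; the end cases
  outside its range are immediate.\<close>

lemma graph_norm_mono:
  assumes "k \<le> m"
  obtains C where "C \<ge> 0" and "\<And>x. x \<in> pow_dom D T m \<Longrightarrow> graph_norm k x \<le> C * graph_norm m x"
proof -
  consider "k = m" | "k = 0" | "0 < k" "k < m" using assms by linarith
  then show ?thesis
  proof cases
    case 1
    then show ?thesis using that[of 1] by simp
  next
    case 2
    then show ?thesis using that[of 2] by (simp add: graph_norm_def)
  next
    case 3
    define \<alpha> where "\<alpha> = (real m - real k) / real m"
    define \<beta> where "\<beta> = real k / real m"
    have ab: "\<alpha> \<ge> 0" "\<beta> \<ge> 0" "\<alpha> + \<beta> = 1"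
      using 3 by (auto simp: \<alpha>_def \<beta>_def simp flip: add_divide_distrib)
    obtain C where C: "C \<ge> 0"
      "\<And>x. x \<in> pow_dom D T m \<Longrightarrow> graph_norm k x \<le> C * graph_norm 0 x powr \<alpha> * graph_norm m x powr \<beta>"
      using moment_inequality[OF 3] unfolding \<alpha>_def \<beta>_def by auto
    have "graph_norm k x \<le> (C * 2 powr \<alpha>) * graph_norm m x" if "x \<in> pow_dom D T m" for x
    proof -
      have "graph_norm k x \<le> C * graph_norm 0 x powr \<alpha> * graph_norm m x powr \<beta>"
        by (rule C(2)[OF that])
      \<comment> \<open>\<open>T ^^ 0\<close> is the identity, so \<open>graph_norm 0 x\<close> is
        \<open>2 * norm x\<close>.\<close>
      also have "\<dots> \<le> C * (2 * graph_norm m x) powr \<alpha> * graph_norm m x powr \<beta>"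
        using C(1) ab
        by (intro mult_mono powr_mono2 order_refl) (auto simp: graph_norm_def)
      also have "\<dots> = (C * 2 powr \<alpha>) * (graph_norm m x powr \<alpha> * graph_norm m x powr \<beta>)"
        using graph_norm_nonneg by (simp add: powr_mult)
      also have "\<dots> = (C * 2 powr \<alpha>) * graph_norm m x"
        using ab graph_norm_nonneg by (simp add: powr_add[symmetric])
      finally show ?thesis .
    qed
    then show ?thesis using that[of "C * 2 powr \<alpha>"] C(1) by simp
  qed
qed

text \<open>A graph-norm Cauchy sequence controls only its own terms and their images under
  \<open>T ^^ n\<close>. By \<open>graph_norm_mono\<close> all lower powers converge as well, and
  closedness of \<open>T\<close> can be used one power at a time.\<close>

lemma complete_pow_dom: "complete_wrt (pow_dom D T n) (graph_norm n)"
  unfolding complete_wrt_def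
proof (intro allI impI)
  fix f :: "nat \<Rightarrow> 'a"
  assume "(\<forall>j. f j \<in> pow_dom D T n) \<and> (\<forall>e>0. \<exists>N. \<forall>i\<ge>N. \<forall>j\<ge>N. graph_norm n (f i - f j) < e)"
  then have f: "\<And>j. f j \<in> pow_dom D T n"
    and cauchy: "\<And>e. e > 0 \<Longrightarrow> \<exists>N. \<forall>i\<ge>N. \<forall>j\<ge>N. graph_norm n (f i - f j) < e" by auto
  have fl: "f j \<in> pow_dom D T l" if "l \<le> n" for j l
    by (rule pow_dom_antimono[OF f that])
  have "convergent (\<lambda>j. (T ^^ l) (f j))" if l: "l \<le> n" for l
  proof (rule Cauchy_convergent, unfold Cauchy_iff, intro allI impI)
    fix e :: real assume "e > 0"
    obtain C where C: "C \<ge> 0" "\<And>x. x \<in> pow_dom D T n \<Longrightarrow> graph_norm l x \<le> C * graph_norm n x"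
      using graph_norm_mono[OF l] by blast
    \<comment> \<open>\<open>C\<close> may be 0, hence the divisor \<open>C + 1\<close>.\<close>
    have "e / (C + 1) > 0" using C(1) \<open>e > 0\<close> by simp
    then obtain N where N: "\<forall>i\<ge>N. \<forall>j\<ge>N. graph_norm n (f i - f j) < e / (C + 1)"
      using cauchy by blast
    have "norm ((T ^^ l) (f i) - (T ^^ l) (f j)) < e" if "i \<ge> N" "j \<ge> N" for i j
    proof -
      have "norm ((T ^^ l) (f i) - (T ^^ l) (f j)) = norm ((T ^^ l) (f i - f j))"
        using funpow_diff(1)[OF fl[OF l] fl[OF l]] by simp
      also have "\<dots> \<le> graph_norm l (f i - f j)" by (rule norm_funpow_le_graph_norm)
      also have "\<dots> \<le> C * graph_norm n (f i - f j)" using C(2) funpow_diff(2) f by blast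
      also have "\<dots> \<le> (C + 1) * graph_norm n (f i - f j)"
        by (intro mult_right_mono graph_norm_nonneg) auto
      also have "\<dots> < (C + 1) * (e / (C + 1))"
        using N that C(1) by (intro mult_strict_left_mono) auto
      also have "\<dots> = e" using C(1) by simp
      finally show ?thesis .
    qed
    then show "\<exists>N. \<forall>i\<ge>N. \<forall>j\<ge>N. norm ((T ^^ l) (f i) - (T ^^ l) (f j)) < e" by blast
  qed
  then obtain y where y: "\<And>l. l \<le> n \<Longrightarrow> (\<lambda>j. (T ^^ l) (f j)) \<longlonglongrightarrow> y l"
    unfolding convergent_def by metis
  \<comment> \<open>The limits form an orbit of \<open>T\<close> starting at \<open>y 0\<close>, the
    limit of \<open>f\<close> itself.\<close>
  have step: "y l \<in> D \<and> T (y l) = y (Suc l)" if "l < n" for l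
  proof (rule closed_opD[OF right_linear closed])
    show "(T ^^ l) (f j) \<in> D" for j using f that by (simp add: pow_dom_iff)
    show "(\<lambda>j. (T ^^ l) (f j)) \<longlonglongrightarrow> y l" using y that by simp
    show "(\<lambda>j. T ((T ^^ l) (f j))) \<longlonglongrightarrow> y (Suc l)" using y[of "Suc l"] that by simp
  qed
  have pow: "(T ^^ l) (y 0) = y l" if "l \<le> n" for l
    using that step by (induction l) auto
  have dom: "y 0 \<in> pow_dom D T n"
    unfolding pow_dom_iff using pow step by simp
  have "(\<lambda>j. graph_norm n (f j - y 0)) = (\<lambda>j. norm (f j - y 0) + norm ((T ^^ n) (f j) - y n))"
    using funpow_diff(1)[OF f dom] pow by (simp add: graph_norm_def)
  also have "\<dots> \<longlonglongrightarrow> 0"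
    using y[of 0] y[of n]
    by (intro tendsto_add_zero tendsto_norm_zero) (auto simp: LIM_zero_iff)
  finally show "\<exists>x\<in>pow_dom D T n. (\<lambda>j. graph_norm n (f j - x)) \<longlonglongrightarrow> 0"
    using dom by blast
qed

section \<open>Banach spaces, interpolation couple and embeddings\<close>

lemma right_banach_space_pow_dom: "right_banach_space (pow_dom_space D T n)"
proof -
  interpret P: right_linear_operator "pow_dom D T n" "T ^^ n"
    by standard (rule right_linear_op_funpow)
  have "right_subspace (pow_dom D T n)"
    using right_linear_op_funpow by (simp add: right_linear_op_def)
  moreover have "graph_norm n x = 0 \<longrightarrow> x = 0" for x
    by (simp add: graph_norm_def add_nonneg_eq_0_iff)
  moreover have "graph_norm n (x *\<^sub>Q s) = graph_norm n x * norm s" if "x \<in> pow_dom D T n" for x s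
    using that by (simp add: graph_norm_def P.scaleQ norm_scaleQ algebra_simps)
  moreover have "graph_norm n (x + y) \<le> graph_norm n x + graph_norm n y"
    if "x \<in> pow_dom D T n" "y \<in> pow_dom D T n" for x y
    using norm_triangle_ineq[of x y] norm_triangle_ineq[of "(T ^^ n) x" "(T ^^ n) y"] that
    by (simp add: graph_norm_def P.add)
  ultimately show ?thesis
    unfolding right_banach_space_def pow_dom_space_eq
    by (simp add: complete_pow_dom graph_norm_nonneg)
qed

text \<open>The ambient Hausdorff space is the Banach space with its norm topology; the inclusion is
  continuous because the graph norm dominates the norm.\<close>

lemma continuous_map_pow_dom_space:
  "continuous_map (norm_topology (pow_dom_space D T n)) euclidean id"
  unfolding continuous_map_def
proof (intro conjI allI impI)
  fix U :: "'a set" assume "openin euclidean U"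
  then have "open U" by (rule open_openin[THEN iffD2])
  have top: "topspace (norm_topology (pow_dom_space D T n)) = pow_dom D T n"
  proof
    show "topspace (norm_topology (pow_dom_space D T n)) \<subseteq> pow_dom D T n"
      using openin_norm_topology[THEN iffD1, OF openin_topspace, THEN conjunct1]
      by (metis pow_dom_space_eq nspace.sel(1))
    \<comment> \<open>Balls are taken within the carrier, so any radius will do.\<close>
    have "openin (norm_topology (pow_dom_space D T n)) (pow_dom D T n)"
      unfolding openin_norm_topology by (auto simp: pow_dom_space_eq intro: exI[of _ 1])
    then show "pow_dom D T n \<subseteq> topspace (norm_topology (pow_dom_space D T n))"
      by (rule openin_subset)
  qed
  have "\<exists>e>0. \<forall>y\<in>pow_dom D T n. graph_norm n (y - x) < e \<longrightarrow> y \<in> U" if "x \<in> U" for x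
  proof -
    obtain e where "e > 0" "\<forall>y. dist y x < e \<longrightarrow> y \<in> U"
      using \<open>open U\<close> \<open>x \<in> U\<close> unfolding open_dist by blast
    then show ?thesis
      using norm_le_graph_norm by (metis dist_norm le_less_trans)
  qed
  then show "openin (norm_topology (pow_dom_space D T n))
      {x \<in> topspace (norm_topology (pow_dom_space D T n)). id x \<in> U}"
    unfolding top openin_norm_topology by (auto simp: pow_dom_space_eq)
qed auto

lemma interpolation_couple_pow_dom:
  "interpolation_couple (pow_dom_space D T n) (pow_dom_space D T m)"
  unfolding interpolation_couple_def
  using continuous_map_pow_dom_space Hausdorff_space_euclidean by blast

lemma inter_space_embedded:
  assumes "k \<le> m"
  shows "inter_space (pow_dom_space D T n) (pow_dom_space D T m) \<hookrightarrow> pow_dom_space D T k"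
proof -
  obtain C where C: "C \<ge> 0" "\<And>x. x \<in> pow_dom D T m \<Longrightarrow> graph_norm k x \<le> C * graph_norm m x"
    using graph_norm_mono[OF assms] by blast
  have "graph_norm k x \<le> C * max (graph_norm n x) (graph_norm m x)" if "x \<in> pow_dom D T m" for x
    using C(2)[OF that] mult_left_mono[OF max.cobounded2 C(1)] by (rule order_trans)
  then show ?thesis
    unfolding cont_embedded_def inter_space_def pow_dom_space_eq
    using C(1) pow_dom_antimono[OF _ assms] by auto
qed

text \<open>The decomposition \<open>x = x + 0\<close> bounds the infimum by
  \<open>graph_norm n x\<close>.\<close>

lemma sum_space_embedded:
  assumes "n \<le> k"
  shows "pow_dom_space D T k \<hookrightarrow> sum_space (pow_dom_space D T n) (pow_dom_space D T m)"
proof -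
  obtain C where C: "C \<ge> 0" "\<And>x. x \<in> pow_dom D T k \<Longrightarrow> graph_norm n x \<le> C * graph_norm k x"
    using graph_norm_mono[OF assms] by blast
  have sub: "pow_dom D T k \<subseteq> pow_dom D T n" by (auto intro: pow_dom_antimono[OF _ assms])
  have zero_in: "0 \<in> pow_dom D T m"
    using right_linear_op_funpow[of m] by (simp add: right_linear_op_def right_subspace_def)
  have zero_nrm: "graph_norm m 0 = 0" by (simp add: graph_norm_def funpow_zero)
  have "Inf {graph_norm n a + graph_norm m b | a b. x = a + b \<and> a \<in> pow_dom D T n \<and> b \<in> pow_dom D T m}
      \<le> C * graph_norm k x" (is "Inf ?A \<le> _") if "x \<in> pow_dom D T k" for x
  proof -
    have "graph_norm n x + graph_norm m 0 \<in> ?A"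
      using zero_in that sub by force
    \<comment> \<open>A real \<open>Inf\<close> is a lower bound only for sets that are bounded
      below.\<close>
    moreover have "bdd_below ?A"
      by (rule bdd_belowI[of _ 0]) (auto intro!: add_nonneg_nonneg graph_norm_nonneg)
    ultimately have "Inf ?A \<le> graph_norm n x + graph_norm m 0" by (rule cInf_lower)
    then show ?thesis using C(2)[OF that] zero_nrm by simp
  qed
  moreover have "\<exists>a b. x = a + b \<and> a \<in> pow_dom D T n \<and> b \<in> pow_dom D T m"
    if "x \<in> pow_dom D T k" for x
    using zero_in that sub by (intro exI[of _ x] exI[of _ 0]) auto
  ultimately show ?thesis
    unfolding cont_embedded_def sum_space_def pow_dom_space_eq using C(1) by auto
qed

lemma pow_dom_space_in_J_class:
  assumes "n < k" and "k < m"
  shows "pow_dom_space D T k \<in> J_class ((real k - real n) / (real m - real n))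
    (pow_dom_space D T n) (pow_dom_space D T m)"
proof -
  obtain C where C: "C \<ge> 0"
    "\<And>x. x \<in> pow_dom D T m \<Longrightarrow>
      graph_norm k x \<le> C * graph_norm n x powr ((real m - real k) / (real m - real n))
                        * graph_norm m x powr ((real k - real n) / (real m - real n))"
    using moment_inequality[OF assms] by blast
  \<comment> \<open>\<open>J_class\<close> writes the first exponent as
    \<open>1 - \<theta>\<close>.\<close>
  have "1 - (real k - real n) / (real m - real n) = (real m - real k) / (real m - real n)"
    using assms by (simp add: field_simps)
  then have "\<forall>x\<in>pow_dom D T n \<inter> pow_dom D T m.
      graph_norm k x \<le> C * graph_norm n x powr (1 - (real k - real n) / (real m - real n))
                        * graph_norm m x powr ((real k - real n) / (real m - real n))"
    using C(2) by simp
  then have "\<exists>C\<ge>0. \<forall>x\<in>carr (pow_dom_space D T n) \<inter> carr (pow_dom_space D T m).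
      nrm (pow_dom_space D T k) x
        \<le> C * nrm (pow_dom_space D T n) x powr (1 - (real k - real n) / (real m - real n))
            * nrm (pow_dom_space D T m) x powr ((real k - real n) / (real m - real n))"
    unfolding pow_dom_space_eq using C(1) by auto
  then show ?thesis
    unfolding J_class_def
    using assms right_banach_space_pow_dom interpolation_couple_pow_dom
      inter_space_embedded[of k m n] sum_space_embedded[of n k m]
    by simp
qed

end

text \<open>The ray meets every modulus \<open>t > 0\<close>, so the resolvent estimate holds for
  all \<open>t\<close>; \<open>square_le_of_scaled_bound\<close> with \<open>C = 7 * M + 2\<close>
  then yields the factor \<open>4 * C\<^sup>2\<close>.\<close>

lemma landau_operatorI:
  fixes D :: "'x::right_quaternionic_banach set"
  assumes lin: "right_linear_op D T" and "closed_op D T"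
    and ray: "S_ray \<omega> \<subseteq> S_resolvent_set D T" and "0 \<le> M"
    and R: "\<And>s. s \<in> S_ray \<omega> \<Longrightarrow> onorm (Q_inv D T s) \<le> M / (norm s)\<^sup>2"
    and TR: "\<And>s. s \<in> S_ray \<omega> \<Longrightarrow>
      bounded_linear (\<lambda>y. T (Q_inv D T s y)) \<and> onorm (\<lambda>y. T (Q_inv D T s y)) \<le> M / norm s"
  shows "landau_operator D T (4 * (7 * M + 2)\<^sup>2)"
proof -
  interpret right_linear_operator D T by standard fact
  have bound: "norm (T x) \<le> (7 * M + 2) * (t * norm x + norm (T (T x)) / t)"
    if x: "x \<in> pow_dom D T 2" and "t > 0" for x t
  proof -
    obtain s where "s \<in> S_ray \<omega>" "norm s = t" using S_ray_norm_surj[OF \<open>t > 0\<close>] .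
    then show ?thesis
      using ray R[of s] TR[of s] \<open>t > 0\<close> x by (intro norm_le_of_resolvent_bounds) auto
  qed
  show ?thesis
  proof
    show "4 * (7 * M + 2)\<^sup>2 > 0" using \<open>0 \<le> M\<close> by simp
    show "(norm (T x))\<^sup>2 \<le> 4 * (7 * M + 2)\<^sup>2 * norm x * norm (T (T x))"
      if "x \<in> pow_dom D T 2" for x
    \<comment> \<open>The optimisation over \<open>t\<close> requires
      \<open>norm x > 0\<close>.\<close>
    proof (cases "x = 0")
      case True
      then show ?thesis by (simp add: zero)
    next
      case False
      then show ?thesis
        using bound[OF that] \<open>0 \<le> M\<close> by (intro square_le_of_scaled_bound) auto
    qed
  qed fact
qed

text \<open>\<open>onorm\<close> is meaningful only for bounded operators: for \<open>Q_inv\<close>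
  boundedness is contained in \<open>S_resolvent_set\<close>, for \<open>T Q_s^-1\<close> it
  accompanies the bound.\<close>

theorem theorem3p6:
  fixes D :: "'x::right_quaternionic_banach set"
    and T :: "'x \<Rightarrow> 'x"
    and \<omega> M :: real
  assumes "right_linear_op D T"
    and "closed_op D T"
    and "0 \<le> \<omega>" and "\<omega> \<le> pi"
    and "S_ray \<omega> \<subseteq> S_resolvent_set D T"
    and "0 \<le> M"
    and "\<And>s. s \<in> S_ray \<omega> \<Longrightarrow> onorm (Q_inv D T s) \<le> M / (norm s)\<^sup>2"
    and "\<And>s. s \<in> S_ray \<omega> \<Longrightarrow>
      bounded_linear (\<lambda>y. T (Q_inv D T s y)) \<and> onorm (\<lambda>y. T (Q_inv D T s y)) \<le> M / norm s"
  shows "\<forall>n k m :: nat. n < k \<and> k < m \<longrightarrow>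
    pow_dom_space D T k
      \<in> J_class ((real k - real n) / (real m - real n)) (pow_dom_space D T n) (pow_dom_space D T m) \<and>
    (\<exists>C\<ge>0. \<forall>x\<in>pow_dom D T m.
       nrm (pow_dom_space D T k) x
         \<le> C * nrm (pow_dom_space D T n) x powr ((real m - real k) / (real m - real n))
             * nrm (pow_dom_space D T m) x powr ((real k - real n) / (real m - real n)))"
proof (intro allI impI, elim conjE)
  fix n k m :: nat assume nkm: "n < k" "k < m"
  interpret landau_operator D T "4 * (7 * M + 2)\<^sup>2"
    by (rule landau_operatorI[of D T \<omega> M, OF assms(1,2,5-8)])
  obtain C where "C \<ge> 0" and "\<And>x. x \<in> pow_dom D T m \<Longrightarrow>
      graph_norm k x \<le> C * graph_norm n x powr ((real m - real k) / (real m - real n))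
                        * graph_norm m x powr ((real k - real n) / (real m - real n))"
    using moment_inequality[OF nkm] by blast
  then show "pow_dom_space D T k
      \<in> J_class ((real k - real n) / (real m - real n)) (pow_dom_space D T n) (pow_dom_space D T m) \<and>
    (\<exists>C\<ge>0. \<forall>x\<in>pow_dom D T m.
       nrm (pow_dom_space D T k) x
         \<le> C * nrm (pow_dom_space D T n) x powr ((real m - real k) / (real m - real n))
             * nrm (pow_dom_space D T m) x powr ((real k - real n) / (real m - real n)))"
    using pow_dom_space_in_J_class[OF nkm] by (auto simp: pow_dom_space_eq)
qed

end
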